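(* Let $k\ge 4$ and let $\ell=(T_{(i)}\mid i\ge 1)\in\operatorname{Lie}((V))$ be a log-signature such that $\varphi_k(\ell)\ne 0$. If either $\varphi_k(\ell)\in\operatorname{Sym}^{k-1}(V)\otimes V$ or $\varphi_k(\ell)\in V\otimes\operatorname{Sym}^{k-1}(V)$, then $\varphi_i(\ell)\in\operatorname{Sym}^i(V)$ for every $i\in\{2,\dots,k\}$.
   Context: Let $\mathbb{K}\in\{\mathbb{R},\mathbb{C}\}$ and let $V$ be a finite-dimensional $\mathbb{K}$-vector space. On the tensor algebra of $V$ consider the Lie bracket $[T,S]=T\otimes S-S\otimes T$. $\operatorname{Lie}(V)$ is the smallest linear subspace of the tensor algebra that contains $V$ and is closed under brackets, and $\operatorname{Lie}^k(V)=\operatorname{Lie}(V)\cap V^{\otimes k}$. $\operatorname{Lie}((V))$ is the set of sequences $\ell=(T_{(i)}\mid i\ge 1)$ with $T_{(i)}\in\operatorname{Lie}^i(V)$ for every $i\ge1$ (the degree-zero entry being $0$); its elements are called log-signatures. For $k\ge 1$, $\varphi_k:\operatorname{Lie}((V))\to V^{\otimes k}$ is the degree-$k$ component of the exponential $\exp(T)=\sum_{n\ge0}T^{\otimes n}/n!$, i.e. $\varphi_k(\ell)=\sum\frac{1}{t!}T_{(\alpha_1)}\otimes\cdots\otimes T_{(\alpha_t)}$, the sum over all tuples of positive integers $(\alpha_1,\dots,\alpha_t)$ (of any length $t$) with $\alpha_1+\cdots+\alpha_t=k$. $\operatorname{Sym}^k(V)\subset V^{\otimes k}$ is the subspace of symmetric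 tensors; $\operatorname{Sym}^{k-1}(V)\otimes V$ (respectively $V\otimes\operatorname{Sym}^{k-1}(V)$) is the subspace of $V^{\otimes k}$ of tensors invariant under permutations of the first (respectively last) $k-1$ indices. *)

theory Defs
  imports
    Complex_Main
    "HOL-Library.Function_Algebras"
    "HOL-Combinatorics.Permutations"
begin

text \<open>
  \<open>V\<close> is a vector space with carrier type \<open>'v\<close> and scalar multiplication
  \<open>scale :: 'k \<Rightarrow> 'v \<Rightarrow> 'v\<close>.  As \<open>V\<close> is finite-dimensional, the \<open>k\<close>-th tensor power of \<open>V\<close> is
  modelled by the \<open>k\<close>-linear forms on the dual space of \<open>V\<close>.  A tensor is a function on lists of
  functionals; an element of the \<open>k\<close>-th tensor power is extended by 0 to all lists that are not
  \<open>k\<close>-tuples of linear functionals, so that tensors of all degrees live in one type and the direct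
  sum of the tensor powers is an internal one.  Sums and 0 of tensors and of functionals are the
  pointwise ones.

  The ground field \<open>\<real>\<close> or \<open>\<complex>\<close> is rendered by the class \<open>real_normed_field\<close>: both are instances, and by
  the theorem of Gelfand and Mazur every field with a multiplicative norm that is also a real
  normed algebra is isomorphic to one of them.
\<close>

type_synonym ('k, 'v) tensor = "('v \<Rightarrow> 'k) list \<Rightarrow> 'k"

definition dual_space :: "('k::field \<Rightarrow> 'v::ab_group_add \<Rightarrow> 'v) \<Rightarrow> ('v \<Rightarrow> 'k) set" where
  "dual_space scale = {f. Vector_Spaces.linear scale (*) f}"

definition tensor_scale :: "'k::field \<Rightarrow> ('k, 'v) tensor \<Rightarrow> ('k, 'v) tensor" where
  "tensor_scale c T = (\<lambda>w. c * T w)"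

definition tensor_power ::
  "('k::field \<Rightarrow> 'v::ab_group_add \<Rightarrow> 'v) \<Rightarrow> nat \<Rightarrow> ('k, 'v) tensor set" where
  "tensor_power scale k = {T.
     (\<forall>w. T w \<noteq> 0 \<longrightarrow> length w = k \<and> set w \<subseteq> dual_space scale) \<and>
     (\<forall>w i f g c. length w = k \<longrightarrow> set w \<subseteq> dual_space scale \<longrightarrow> i < k \<longrightarrow>
        f \<in> dual_space scale \<longrightarrow> g \<in> dual_space scale \<longrightarrow>
        T (w[i := f + g]) = T (w[i := f]) + T (w[i := g]) \<and>
        T (w[i := (\<lambda>x. c * f x)]) = c * T (w[i := f]))}"

definition tensor_algebra ::
  "('k::field \<Rightarrow> 'v::ab_group_add \<Rightarrow> 'v) \<Rightarrow> ('k, 'v) tensor set" where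
  "tensor_algebra scale = module.span tensor_scale (\<Union>k. tensor_power scale k)"

text \<open>The canonical map of \<open>V\<close> onto the first tensor power, \<open>v \<mapsto> (f \<mapsto> f v)\<close>.\<close>

definition tensor_vec ::
  "('k::field \<Rightarrow> 'v::ab_group_add \<Rightarrow> 'v) \<Rightarrow> 'v \<Rightarrow> ('k, 'v) tensor" where
  "tensor_vec scale v =
     (\<lambda>w. if length w = 1 \<and> set w \<subseteq> dual_space scale then hd w v else 0)"

definition tensor_one :: "('k::field, 'v) tensor" where
  "tensor_one = (\<lambda>w. if w = [] then 1 else 0)"

text \<open>
  If \<open>T\<close> has degree \<open>j\<close> and \<open>S\<close> has degree \<open>k\<close>, only the summand \<open>i = j\<close> can be nonzero, and the
  product is \<open>(f\<^sub>1, \<dots>, f\<^bsub>j+k\<^esub>) \<mapsto> T (f\<^sub>1, \<dots>, f\<^sub>j) * S (f\<^bsub>j+1\<^esub>, \<dots>, f\<^bsub>j+k\<^esub>)\<close>; the sum over all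
  splittings is its bilinear extension to the whole tensor algebra.
\<close>

definition tensor_mult ::
  "('k::field, 'v) tensor \<Rightarrow> ('k, 'v) tensor \<Rightarrow> ('k, 'v) tensor" (infixl "\<otimes>\<^sub>t" 70) where
  "T \<otimes>\<^sub>t S = (\<lambda>w. \<Sum>i\<le>length w. T (take i w) * S (drop i w))"

definition tensor_bracket ::
  "('k::field, 'v) tensor \<Rightarrow> ('k, 'v) tensor \<Rightarrow> ('k, 'v) tensor" where
  "tensor_bracket T S = T \<otimes>\<^sub>t S - S \<otimes>\<^sub>t T"

inductive_set Lie :: "('k::field \<Rightarrow> 'v::ab_group_add \<Rightarrow> 'v) \<Rightarrow> ('k, 'v) tensor set"
  for scale :: "'k \<Rightarrow> 'v \<Rightarrow> 'v" where
  Lie_vec: "tensor_vec scale v \<in> Lie scale"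
| Lie_zero: "0 \<in> Lie scale"
| Lie_add: "T \<in> Lie scale \<Longrightarrow> S \<in> Lie scale \<Longrightarrow> T + S \<in> Lie scale"
| Lie_scale: "T \<in> Lie scale \<Longrightarrow> tensor_scale c T \<in> Lie scale"
| Lie_bracket: "T \<in> Lie scale \<Longrightarrow> S \<in> Lie scale \<Longrightarrow> tensor_bracket T S \<in> Lie scale"

definition Lie_deg ::
  "('k::field \<Rightarrow> 'v::ab_group_add \<Rightarrow> 'v) \<Rightarrow> nat \<Rightarrow> ('k, 'v) tensor set" where
  "Lie_deg scale k = Lie scale \<inter> tensor_power scale k"

definition log_signatures ::
  "('k::field \<Rightarrow> 'v::ab_group_add \<Rightarrow> 'v) \<Rightarrow> (nat \<Rightarrow> ('k, 'v) tensor) set" where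
  "log_signatures scale = {l. l 0 = 0 \<and> (\<forall>i\<ge>1. l i \<in> Lie_deg scale i)}"

definition compositions :: "nat \<Rightarrow> nat list set" where
  "compositions k = {\<alpha>. (\<forall>a\<in>set \<alpha>. 1 \<le> a) \<and> sum_list \<alpha> = k}"

definition sig_component :: "nat \<Rightarrow> (nat \<Rightarrow> ('k::field_char_0, 'v) tensor) \<Rightarrow> ('k, 'v) tensor" where
  "sig_component k l =
     (\<Sum>\<alpha>\<in>compositions k.
        tensor_scale (1 / fact (length \<alpha>)) (foldr (\<otimes>\<^sub>t) (map l \<alpha>) tensor_one))"

text \<open>Tensors of degree \<open>k\<close> invariant under all permutations of the positions in \<open>I \<subseteq> {0, \<dots>, k - 1}\<close>.\<close>

definition invariant_tensors ::
  "('k::field \<Rightarrow> 'v::ab_group_add \<Rightarrow> 'v) \<Rightarrow> nat \<Rightarrow> nat set \<Rightarrow> ('k, 'v) tensor set" where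
  "invariant_tensors scale k I = {T \<in> tensor_power scale k.
     \<forall>p. p permutes I \<longrightarrow> (\<forall>w. length w = k \<longrightarrow> T (permute_list p w) = T w)}"

definition Sym ::
  "('k::field \<Rightarrow> 'v::ab_group_add \<Rightarrow> 'v) \<Rightarrow> nat \<Rightarrow> ('k, 'v) tensor set" where
  "Sym scale k = invariant_tensors scale k {0..<k}"

definition Sym_tensor_V ::
  "('k::field \<Rightarrow> 'v::ab_group_add \<Rightarrow> 'v) \<Rightarrow> nat \<Rightarrow> ('k, 'v) tensor set" where
  "Sym_tensor_V scale k = invariant_tensors scale k {0..<k - 1}"

definition V_tensor_Sym ::
  "('k::field \<Rightarrow> 'v::ab_group_add \<Rightarrow> 'v) \<Rightarrow> nat \<Rightarrow> ('k, 'v) tensor set" where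
  "V_tensor_Sym scale k = invariant_tensors scale k {1..<k}"


subsection \<open>Consistency of the definitions\<close>

lemma finite_compositions: "finite (compositions k)"
proof (rule finite_subset)
  show "compositions k \<subseteq> {\<alpha>. set \<alpha> \<subseteq> {..k} \<and> length \<alpha> \<le> k}"
  proof (clarsimp simp: compositions_def, intro conjI)
    fix \<alpha> :: "nat list" assume a: "\<forall>a\<in>set \<alpha>. Suc 0 \<le> a"
    show "set \<alpha> \<subseteq> {..sum_list \<alpha>}" by (auto intro: member_le_sum_list)
    show "length \<alpha> \<le> sum_list \<alpha>" using a by (induction \<alpha>) auto
  qed
  show "finite {\<alpha>. set \<alpha> \<subseteq> {..k} \<and> length \<alpha> \<le> k}" by (rule finite_lists_length_le) simp
qed

lemma vector_space_tensor_scale: "vector_space tensor_scale"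
  by unfold_locales (auto simp: tensor_scale_def fun_eq_iff algebra_simps)

lemma tensor_mult_homogeneous:
  assumes T: "T \<in> tensor_power scale j" and w: "length w = j + k"
  shows "(T \<otimes>\<^sub>t S) w = T (take j w) * S (drop j w)"
proof -
  have "T (take i w) * S (drop i w) = 0" if "i \<le> length w" "i \<noteq> j" for i
    using T that by (force simp: tensor_power_def)
  hence "(T \<otimes>\<^sub>t S) w = (\<Sum>i\<in>{j}. T (take i w) * S (drop i w))"
    unfolding tensor_mult_def using w by (intro sum.mono_neutral_right) auto
  thus ?thesis by simp
qed

lemma tensor_mult_power:
  assumes T: "T \<in> tensor_power scale j" and S: "S \<in> tensor_power scale k"
  shows "T \<otimes>\<^sub>t S \<in> tensor_power scale (j + k)"
proof -
  have supp: "length w = j + k \<and> set w \<subseteq> dual_space scale" if nz: "(T \<otimes>\<^sub>t S) w \<noteq> 0" for w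
  proof -
    have "\<exists>i\<le>length w. T (take i w) * S (drop i w) \<noteq> 0"
      using nz unfolding tensor_mult_def by (meson atMost_iff sum.neutral)
    then obtain i where i: "i \<le> length w" "T (take i w) \<noteq> 0" "S (drop i w) \<noteq> 0" by auto
    have "length (take i w) = j" "set (take i w) \<subseteq> dual_space scale"
         "length (drop i w) = k" "set (drop i w) \<subseteq> dual_space scale"
      using T S i unfolding tensor_power_def mem_Collect_eq by metis+
    moreover have "set w = set (take i w) \<union> set (drop i w)"
      by (metis append_take_drop_id set_append)
    ultimately show ?thesis using i(1) by auto
  qed
  have lin: "(T \<otimes>\<^sub>t S) (w[i := f + g]) = (T \<otimes>\<^sub>t S) (w[i := f]) + (T \<otimes>\<^sub>t S) (w[i := g]) \<and>
        (T \<otimes>\<^sub>t S) (w[i := (\<lambda>x. c * f x)]) = c * (T \<otimes>\<^sub>t S) (w[i := f])"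
    if w: "length w = j + k" "set w \<subseteq> dual_space scale" "i < j + k"
      "f \<in> dual_space scale" "g \<in> dual_space scale" for w i f g c
  proof -
    have eq: "(T \<otimes>\<^sub>t S) (w[i := h]) = T (take j (w[i := h])) * S (drop j (w[i := h]))" for h
      using tensor_mult_homogeneous[OF T, of "w[i := h]"] w by simp
    have sub: "set (take j w) \<subseteq> dual_space scale" "set (drop j w) \<subseteq> dual_space scale"
      using w(2) set_take_subset set_drop_subset by fast+
    show ?thesis
    proof (cases "i < j")
      case True
      have d: "drop j (w[i := h]) = drop j w" for h using True by simp
      have t: "take j (w[i := h]) = (take j w)[i := h]" for h by (simp add: take_update_swap)
      have "T ((take j w)[i := f + g]) = T ((take j w)[i := f]) + T ((take j w)[i := g])"
           "T ((take j w)[i := (\<lambda>x. c * f x)]) = c * T ((take j w)[i := f])"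
        using T True w sub unfolding tensor_power_def by auto
      thus ?thesis by (simp only: eq d t) (simp add: algebra_simps)
    next
      case False
      have d: "drop j (w[i := h]) = (drop j w)[i - j := h]" for h
        using False by (simp add: drop_update_swap)
      have t: "take j (w[i := h]) = take j w" for h using False by simp
      have "i - j < k" using False w by auto
      hence "S ((drop j w)[i-j := f + g]) = S ((drop j w)[i-j := f]) + S ((drop j w)[i-j := g])"
           "S ((drop j w)[i-j := (\<lambda>x. c * f x)]) = c * S ((drop j w)[i-j := f])"
        using S w sub unfolding tensor_power_def by auto
      thus ?thesis by (simp only: eq d t) (simp add: algebra_simps)
    qed
  qed
  show ?thesis unfolding tensor_power_def using supp lin by blast
qed

lemma tensor_vec_power:
  fixes scale :: "'k::field \<Rightarrow> 'v::ab_group_add \<Rightarrow> 'v"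
  assumes "vector_space scale"
  shows "tensor_vec scale v \<in> tensor_power scale 1"
proof -
  interpret vector_space scale by fact
  have k: "vector_space ((*) :: 'k \<Rightarrow> 'k \<Rightarrow> 'k)" by unfold_locales (auto simp: algebra_simps)
  have lin: "f + g \<in> dual_space scale" "(\<lambda>x. c * f x) \<in> dual_space scale"
    if "f \<in> dual_space scale" "g \<in> dual_space scale" for f g c
    using that unfolding dual_space_def
    by (auto simp: Vector_Spaces.linear_iff algebra_simps)
  show ?thesis
    unfolding tensor_power_def tensor_vec_def
    using lin by (auto simp: length_Suc_conv split: if_splits)
qed

lemma tensor_vec_bij:
  fixes scale :: "'k::field \<Rightarrow> 'v::ab_group_add \<Rightarrow> 'v"
  assumes "finite_dimensional_vector_space scale Basis"
  shows "bij_betw (tensor_vec scale) UNIV (tensor_power scale 1)"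
proof -
  interpret finite_dimensional_vector_space scale Basis by fact
  have k: "vector_space ((*) :: 'k \<Rightarrow> 'k \<Rightarrow> 'k)" by unfold_locales (auto simp: algebra_simps)
  define coord where "coord b = (\<lambda>v. representation Basis v b)" for b
  have vs: "vector_space scale" by unfold_locales
  have coord: "coord b \<in> dual_space scale" for b
    unfolding dual_space_def coord_def
    by (simp add: Vector_Spaces.linear_iff vs k representation_add representation_scale
        independent_Basis span_Basis)
  have expand: "v = (\<Sum>b\<in>Basis. scale (coord b v) b)" for v
    unfolding coord_def
    using sum_representation_eq[OF independent_Basis _ finite_Basis, of v] span_Basis by simp
  have vec: "tensor_vec scale v [f] = f v" if "f \<in> dual_space scale" for v f
    using that by (simp add: tensor_vec_def)
  have "inj (tensor_vec scale)"
  proof (rule injI)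
    fix u v assume "tensor_vec scale u = tensor_vec scale v"
    hence "coord b u = coord b v" for b using vec[OF coord] by metis
    thus "u = v" using expand[of u] expand[of v] by simp
  qed
  moreover have "T \<in> range (tensor_vec scale)" if T: "T \<in> tensor_power scale 1" for T
  proof -
    have add: "T [f + g] = T [f] + T [g]" and scl: "T [\<lambda>x. c * f x] = c * T [f]"
      if "f \<in> dual_space scale" "g \<in> dual_space scale" for f g c
    proof -
      have "T ([f][0 := f + g]) = T ([f][0 := f]) + T ([f][0 := g]) \<and>
            T ([f][0 := (\<lambda>x. c * f x)]) = c * T ([f][0 := f])"
        using T that unfolding tensor_power_def mem_Collect_eq
        by (elim conjE allE[of _ "[f]"] allE[of _ 0] allE[of _ f] allE[of _ g] allE[of _ c]) simp
      thus "T [f + g] = T [f] + T [g]" "T [\<lambda>x. c * f x] = c * T [f]" by simp_all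
    qed
    have zero: "(0 :: 'v \<Rightarrow> 'k) \<in> dual_space scale"
      by (simp add: dual_space_def Vector_Spaces.linear_iff vs k)
    have T0: "T [0] = 0" using add[OF zero zero] unfolding add_0_left by (metis add_cancel_left_left)
    have plus: "f + g \<in> dual_space scale" and sc: "(\<lambda>x. c * f x) \<in> dual_space scale"
      if "f \<in> dual_space scale" "g \<in> dual_space scale" for f g c
      using that unfolding dual_space_def
      by (auto simp: Vector_Spaces.linear_iff algebra_simps)
    define v where "v = (\<Sum>b\<in>Basis. scale (T [coord b]) b)"
    have main: "T [f] = f v" if f: "f \<in> dual_space scale" for f
    proof -
      interpret f: Vector_Spaces.linear scale "(*)" f using f by (simp add: dual_space_def)
      have sum_apply: "(\<Sum>b\<in>A. (h b :: 'v \<Rightarrow> 'k)) x = (\<Sum>b\<in>A. h b x)" for A :: "'v set" and h x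
        by (induction A rule: infinite_finite_induct) auto
      have aux: "(\<Sum>b\<in>A. (\<lambda>x. f b * coord b x)) \<in> dual_space scale \<and>
            T [\<Sum>b\<in>A. (\<lambda>x. f b * coord b x)] = (\<Sum>b\<in>A. f b * T [coord b])" if "finite A" for A
        using that
      proof induction
        case empty
        show ?case unfolding sum.empty using zero T0 by blast
      next
        case (insert b A)
        note b = sc[OF coord coord, of "f b" b]
        show ?case unfolding sum.insert[OF insert(1,2)]
          using plus[OF b] add[OF b] scl[OF coord coord, of "f b" b] insert.IH by presburger
      qed
      have "f = (\<Sum>b\<in>Basis. (\<lambda>x. f b * coord b x))"
      proof
        fix x
        have "f x = (\<Sum>b\<in>Basis. coord b x * f b)"
          by (subst (1) expand[of x]) (simp only: f.sum f.scale)
        thus "f x = (\<Sum>b\<in>Basis. (\<lambda>x. f b * coord b x)) x"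
          by (simp add: sum_apply mult.commute)
      qed
      hence "T [f] = (\<Sum>b\<in>Basis. f b * T [coord b])" using aux[OF finite_Basis] by simp
      also have "\<dots> = f v" by (simp add: v_def f.sum f.scale mult.commute)
      finally show ?thesis .
    qed
    have "T w = tensor_vec scale v w" for w
    proof (cases "length w = 1 \<and> set w \<subseteq> dual_space scale")
      case True
      then obtain f where "w = [f]" "f \<in> dual_space scale" by (auto simp: length_Suc_conv)
      thus ?thesis by (simp add: main vec)
    next
      case False
      thus ?thesis using T by (auto simp: tensor_power_def tensor_vec_def)
    qed
    thus ?thesis by blast
  qed
  ultimately show ?thesis
    using tensor_vec_power[OF vs] by (auto simp: bij_betw_def)
qed

lemma tensor_mult_bilinear:
  "(T + T') \<otimes>\<^sub>t S = T \<otimes>\<^sub>t S + T' \<otimes>\<^sub>t S" "T \<otimes>\<^sub>t (S + S') = T \<otimes>\<^sub>t S + T \<otimes>\<^sub>t S'"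
  "tensor_scale c T \<otimes>\<^sub>t S = tensor_scale c (T \<otimes>\<^sub>t S)"
  "T \<otimes>\<^sub>t tensor_scale c S = tensor_scale c (T \<otimes>\<^sub>t S)"
  "0 \<otimes>\<^sub>t S = 0" "T \<otimes>\<^sub>t 0 = 0"
  by (auto simp: tensor_mult_def tensor_scale_def fun_eq_iff algebra_simps sum.distrib
      sum_distrib_left)

lemma tensor_mult_algebra:
  fixes T S :: "('k::field, 'v::ab_group_add) tensor"
  assumes "T \<in> tensor_algebra scale" "S \<in> tensor_algebra scale"
  shows "T \<otimes>\<^sub>t S \<in> tensor_algebra scale"
proof -
  interpret t: vector_space "tensor_scale :: 'k \<Rightarrow> ('k, 'v) tensor \<Rightarrow> _"
    by (rule vector_space_tensor_scale)
  let ?P = "\<Union>k. tensor_power scale k"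
  have 1: "A \<otimes>\<^sub>t B \<in> t.span ?P" if "A \<in> ?P" "B \<in> ?P" for A B
    using that tensor_mult_power by (intro t.span_base) blast
  have 2: "A \<otimes>\<^sub>t B \<in> t.span ?P" if A: "A \<in> ?P" and B: "B \<in> t.span ?P" for A B
    using B
  proof (induction rule: t.span_induct_alt)
    case base
    show ?case unfolding tensor_mult_bilinear by (rule t.span_zero)
  next
    case (step c B B')
    show ?case unfolding tensor_mult_bilinear
      by (rule t.span_add[OF t.span_scale[OF 1[OF A step(1)]] step(2)])
  qed
  have "A \<otimes>\<^sub>t B \<in> t.span ?P" if B: "B \<in> t.span ?P" and A: "A \<in> t.span ?P" for A B
    using A
  proof (induction rule: t.span_induct_alt)
    case base
    show ?case unfolding tensor_mult_bilinear by (rule t.span_zero)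
  next
    case (step c A A')
    show ?case unfolding tensor_mult_bilinear
      by (rule t.span_add[OF t.span_scale[OF 2[OF step(1) B]] step(2)])
  qed
  thus ?thesis using assms unfolding tensor_algebra_def by blast
qed

text \<open>
  Hence \<open>Lie scale\<close>, which is by definition the smallest linear subspace containing \<open>V\<close> and closed
  under brackets, is a subspace of the tensor algebra.
\<close>

lemma Lie_subset_tensor_algebra:
  fixes scale :: "'k::field \<Rightarrow> 'v::ab_group_add \<Rightarrow> 'v"
  assumes "vector_space scale"
  shows "Lie scale \<subseteq> tensor_algebra scale"
proof
  interpret t: vector_space "tensor_scale :: 'k \<Rightarrow> ('k, 'v) tensor \<Rightarrow> _"
    by (rule vector_space_tensor_scale)
  fix T assume "T \<in> Lie scale"
  thus "T \<in> tensor_algebra scale"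
  proof induction
    case (Lie_vec v)
    thus ?case using tensor_vec_power[OF assms, of v] unfolding tensor_algebra_def
      by (intro t.span_base) blast
  next
    case (Lie_bracket T S)
    thus ?case using tensor_mult_algebra unfolding tensor_bracket_def
      by (metis t.span_diff tensor_algebra_def)
  next
    case Lie_zero
    show ?case unfolding tensor_algebra_def by (rule t.span_zero)
  next
    case (Lie_add T S)
    thus ?case unfolding tensor_algebra_def by (intro t.span_add)
  next
    case (Lie_scale T c)
    thus ?case unfolding tensor_algebra_def by (intro t.span_scale)
  qed
qed

end

theory Submission
  imports Defs
begin

text \<open>
  Collect the components \<open>\<phi>\<^sub>n(\<ell>)\<close> into one function \<open>S\<close> on words whose letters are functionals on
  \<open>V\<close>.  The argument has two halves.

  The first half is the theorem of Ree, in the direction that makes \<open>S\<close> a character of the shuffle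
  algebra: the sum of \<open>S\<close> over all shuffles of \<open>u\<close> and \<open>v\<close> is \<open>S u * S v\<close>
  (\<open>shuffle_character_signature\<close>).  Summing over shuffles is the coproduct for which vectors are
  primitive; it is multiplicative for the tensor product (\<open>shuffle_sum_tensor_mult\<close>), so that Lie
  elements are primitive (\<open>primitive_Lie\<close>) and the exponential of a primitive series is group-like
  (\<open>shuffle_character_tensor_exp\<close>).

  The second half uses nothing about \<open>S\<close> but this and multilinearity.  Let \<open>\<phi>\<^sub>k(\<ell>)\<close> be invariant under
  permutations of the last \<open>k - 1\<close> positions; the other case follows by reading words backwards.
  In degree \<open>k\<close> the value of \<open>S\<close> on a word then depends only on the multiset of its letters and on the
  first letter, so a product \<open>S (a # u) * S (b # v)\<close> in that degree is a combination, with binomial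
  coefficients, of just two values (\<open>shuffle_top_degree\<close>).  Call a letter \<open>a\<close> with \<open>S [a] = 0\<close> a kernel
  letter.

  \<^item> Two kernel letters in a word of length \<open>k\<close> force \<open>S\<close> to vanish there: multiplying by a kernel letter
    gives \<open>0\<close>, and this expresses the values with first letters \<open>a\<close> and \<open>b\<close> as \<open>-(k - 1)\<close> times each
    other.  As \<open>\<phi>\<^sub>k(\<ell>) \<noteq> 0\<close>, not every letter is a kernel letter, and there is \<open>e\<close> with \<open>S [e] = 1\<close>.

  \<^item> A single kernel letter \<open>a\<close> among letters \<open>e\<close> does so too.  Write \<open>g\<close> for the value of \<open>S\<close> on the words
    that begin with \<open>e\<close>.  Both \<open>S [a, e]\<close> and \<open>S (a e\<^bsup>k-3\<^esup>)\<close> are multiples of \<open>g\<close> (shuffle with powers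
    of \<open>e\<close>), while their product is a combination of values on words with two letters \<open>a\<close>, hence \<open>0\<close>.
    For \<open>k \<ge> 4\<close> both multiples are nonzero, so \<open>g\<^sup>2 = 0\<close>.  For \<open>k = 3\<close> the second factor is
    \<open>S [a] = 0\<close>, and the statement fails if \<open>dim V \<ge> 2\<close>.

  Every functional is a multiple of \<open>e\<close> plus a kernel letter, so expanding multilinearly leaves only
  \<open>S (f\<^sub>1, \<dots>, f\<^sub>k) = S [f\<^sub>1] * \<dots> * S [f\<^sub>k] / k!\<close>, that is \<open>\<phi>\<^sub>k(\<ell>) = T\<^bsub>(1)\<^esub>\<^bsup>\<otimes>k\<^esup> / k!\<close>.  Shuffling a shorter word
  with a power of \<open>e\<close> transfers the symmetry from degree \<open>k\<close> to all smaller degrees.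
\<close>

section \<open>Sums over shuffles\<close>

text \<open>
  Shuffles are counted with multiplicity: equal words that arise from different interleavings contribute
  separately, so there are \<open>(length u + length v) choose length u\<close> summands.
\<close>

fun shuffle_sum :: "('a list \<Rightarrow> 'k::comm_semiring_1) \<Rightarrow> 'a list \<Rightarrow> 'a list \<Rightarrow> 'k" where
  "shuffle_sum T [] v = T v"
| "shuffle_sum T (a # u) [] = T (a # u)"
| "shuffle_sum T (a # u) (b # v) =
     shuffle_sum (\<lambda>w. T (a # w)) u (b # v) + shuffle_sum (\<lambda>w. T (b # w)) (a # u) v"

lemma shuffle_sum_Nil2 [simp]: "shuffle_sum T u [] = T u"
  by (cases u) auto

lemma shuffle_sum_cong:
  assumes "\<And>w. mset w = mset u + mset v \<Longrightarrow> T w = T' w"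
  shows "shuffle_sum T u v = shuffle_sum T' u v"
  using assms
proof (induction u v arbitrary: T T' rule: shuffles.induct)
  case (3 a u b v)
  have "shuffle_sum (\<lambda>w. T (a # w)) u (b # v) = shuffle_sum (\<lambda>w. T' (a # w)) u (b # v)"
    by (rule "3.IH"(1)) (rule "3.prems", simp)
  moreover have "shuffle_sum (\<lambda>w. T (b # w)) (a # u) v = shuffle_sum (\<lambda>w. T' (b # w)) (a # u) v"
    by (rule "3.IH"(2)) (rule "3.prems", simp)
  ultimately show ?case by simp
qed auto

lemma shuffle_sum_const:
  "shuffle_sum (\<lambda>w. c) u v = of_nat ((length u + length v) choose length u) * c"
proof (induction u v rule: shuffles.induct)
  case (3 a u b v)
  then show ?case by (simp add: algebra_simps)
qed auto

lemma shuffle_sum_constant_on: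
  assumes "\<And>w. mset w = mset u + mset v \<Longrightarrow> T w = c"
  shows "shuffle_sum T u v = of_nat ((length u + length v) choose length u) * c"
  using shuffle_sum_cong[of u v T "\<lambda>_. c"] assms by (simp add: shuffle_sum_const)

lemma shuffle_sum_linear:
  "shuffle_sum (\<lambda>w. c * T w + d * U w) u v = c * shuffle_sum T u v + d * shuffle_sum U u v"
  by (induction u v arbitrary: T U rule: shuffles.induct) (auto simp: algebra_simps)

lemma shuffle_sum_sum:
  "shuffle_sum (\<lambda>w. \<Sum>n\<in>A. T n w) u v = (\<Sum>n\<in>A. shuffle_sum (T n) u v)"
  by (induction u v arbitrary: T rule: shuffles.induct) (auto simp: sum.distrib)

text \<open>
  The recursion for \<open>shuffle_sum\<close> peels off first letters.  Doing the same at the last letters is what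
  makes sums over shuffles compatible with reading words backwards.
\<close>

lemma shuffle_sum_snoc:
  "shuffle_sum T (u @ [a]) (v @ [b]) =
     shuffle_sum (\<lambda>w. T (w @ [a])) u (v @ [b]) + shuffle_sum (\<lambda>w. T (w @ [b])) (u @ [a]) v"
proof (induction u v arbitrary: T rule: shuffles.induct)
  case (1 v)
  show ?case
  proof (induction v arbitrary: T)
    case (Cons c v)
    show ?case using Cons[of "\<lambda>w. T (c # w)"] by (simp add: algebra_simps)
  qed (simp add: add.commute)
next
  case (2 u)
  show ?case
  proof (induction u arbitrary: T)
    case (Cons c u)
    show ?case using Cons[of "\<lambda>w. T (c # w)"] by (simp add: algebra_simps)
  qed (simp add: add.commute)
next
  case (3 c u d v)
  show ?case
    using "3.IH"(1)[of "\<lambda>w. T (c # w)"] "3.IH"(2)[of "\<lambda>w. T (d # w)"]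
    by (simp add: algebra_simps)
qed

lemma shuffle_sum_rev:
  "shuffle_sum (\<lambda>w. T (rev w)) u v = shuffle_sum T (rev u) (rev v)"
proof (induction u v arbitrary: T rule: shuffles.induct)
  case (3 a u b v)
  show ?case
    using "3.IH"(1)[of "\<lambda>w. T (w @ [a])"] "3.IH"(2)[of "\<lambda>w. T (w @ [b])"]
    by (simp add: shuffle_sum_snoc)
qed auto

text \<open>
  Multiplicativity of the coproduct: cutting a shuffle of \<open>u\<close> and \<open>v\<close> into two pieces cuts \<open>u\<close> and \<open>v\<close> into
  two pieces each and leaves shuffles of the respective pieces.  The induction rests on the Leibniz
  rule for removing the first letter of a product, the equation \<open>Cons\<close> in the proof.
\<close>

lemma shuffle_sum_tensor_mult:
  "shuffle_sum (T \<otimes>\<^sub>t S) u v =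
     (\<Sum>i\<le>length u. \<Sum>j\<le>length v.
        shuffle_sum T (take i u) (take j v) * shuffle_sum S (drop i u) (drop j v))"
proof (induction u v arbitrary: T rule: shuffles.induct)
  case (3 a u b v)
  have Cons: "(T \<otimes>\<^sub>t S) (c # w) = T [] * S (c # w) + 1 * ((\<lambda>w. T (c # w)) \<otimes>\<^sub>t S) w" for c w
    by (simp add: tensor_mult_def sum.atMost_Suc_shift del: sum.atMost_Suc)
  show ?case
    unfolding shuffle_sum.simps Cons
    unfolding shuffle_sum_linear "3.IH"
    by (simp add: sum.atMost_Suc_shift sum.distrib algebra_simps del: sum.atMost_Suc)
qed (simp_all add: tensor_mult_def)

section \<open>Lie elements are primitive\<close>

text \<open>
  The coproduct of \<open>T\<close> is \<open>T \<otimes> 1 + 1 \<otimes> T\<close>: sums over shuffles of two nonempty words vanish, and for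
  \<open>u = v = []\<close> the equation gives \<open>T [] = 0\<close>.
\<close>

definition primitive :: "('k::field, 'v) tensor \<Rightarrow> bool" where
  "primitive T \<longleftrightarrow> (\<forall>u v. shuffle_sum T u v = T u * tensor_one v + tensor_one u * T v)"

lemma primitiveD:
  "primitive T \<Longrightarrow> shuffle_sum T u v = T u * tensor_one v + tensor_one u * T v"
  by (simp add: primitive_def)

lemma tensor_one_take:
  "(\<Sum>j\<le>length v. tensor_one (take j v) * f j) = f 0"
proof -
  have "(\<Sum>j\<le>length v. tensor_one (take j v) * f j) = (\<Sum>j\<in>{0}. tensor_one (take j v) * f j)"
    by (rule sum.mono_neutral_right) (auto simp: tensor_one_def)
  thus ?thesis by (simp add: tensor_one_def)
qed

lemma tensor_one_right [simp]: "T \<otimes>\<^sub>t tensor_one = T"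
proof
  fix w
  have "(T \<otimes>\<^sub>t tensor_one) w = (\<Sum>i\<in>{length w}. T (take i w) * tensor_one (drop i w))"
    unfolding tensor_mult_def by (rule sum.mono_neutral_right) (auto simp: tensor_one_def)
  thus "(T \<otimes>\<^sub>t tensor_one) w = T w" by (simp add: tensor_one_def)
qed

lemma shuffle_sum_primitive_mult:
  assumes "primitive T"
  shows "shuffle_sum (T \<otimes>\<^sub>t S) u v =
     (\<Sum>i\<le>length u. T (take i u) * shuffle_sum S (drop i u) v) +
     (\<Sum>j\<le>length v. T (take j v) * shuffle_sum S u (drop j v))"
proof -
  let ?s = "\<lambda>i j. shuffle_sum S (drop i u) (drop j v)"
  have "shuffle_sum (T \<otimes>\<^sub>t S) u v =
     (\<Sum>i\<le>length u. T (take i u) * (\<Sum>j\<le>length v. tensor_one (take j v) * ?s i j)) +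
     (\<Sum>i\<le>length u. tensor_one (take i u) * (\<Sum>j\<le>length v. T (take j v) * ?s i j))"
    unfolding shuffle_sum_tensor_mult primitiveD[OF assms]
    by (simp add: sum.distrib sum_distrib_left algebra_simps)
  thus ?thesis by (simp add: tensor_one_take)
qed

text \<open>
  The coproduct of \<open>A \<otimes>\<^sub>t B\<close> has the mixed terms \<open>A u * B v + A v * B u\<close>, which are symmetric in \<open>A\<close>
  and \<open>B\<close> and cancel in the bracket.
\<close>

lemma primitive_bracket:
  fixes T S :: "('k::field, 'v) tensor"
  assumes T: "primitive T" and S: "primitive S"
  shows "primitive (tensor_bracket T S)"
proof -
  have mult: "shuffle_sum (A \<otimes>\<^sub>t B) u v =
      (A \<otimes>\<^sub>t B) u * tensor_one v + tensor_one u * (A \<otimes>\<^sub>t B) v + (A u * B v + A v * B u)"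
    if "primitive A" "primitive B" for A B :: "('k, 'v) tensor" and u v
  proof -
    have "shuffle_sum (A \<otimes>\<^sub>t B) u v =
       (A \<otimes>\<^sub>t B) u * tensor_one v + (A \<otimes>\<^sub>t tensor_one) u * B v +
       ((A \<otimes>\<^sub>t tensor_one) v * B u + tensor_one u * (A \<otimes>\<^sub>t B) v)"
      unfolding shuffle_sum_primitive_mult[OF that(1)] primitiveD[OF that(2)]
      unfolding tensor_mult_def
      by (simp add: sum.distrib sum_distrib_left sum_distrib_right algebra_simps)
    thus ?thesis by (simp add: algebra_simps)
  qed
  have eq: "tensor_bracket T S = (\<lambda>w. 1 * (T \<otimes>\<^sub>t S) w + (- 1) * (S \<otimes>\<^sub>t T) w)"
    by (auto simp: tensor_bracket_def)
  show ?thesis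
    unfolding primitive_def eq shuffle_sum_linear
    by (simp add: mult T S algebra_simps)
qed

lemma primitive_Lie:
  assumes "T \<in> Lie scale"
  shows "primitive T"
  using assms
proof induction
  case (Lie_vec v)
  have "shuffle_sum (tensor_vec scale v) x y = 0" if "x \<noteq> []" "y \<noteq> []" for x y
  proof -
    have "shuffle_sum (tensor_vec scale v) x y = shuffle_sum (\<lambda>w. 0) x y"
    proof (rule shuffle_sum_cong)
      fix w assume "mset w = mset x + mset y"
      hence "length w = length x + length y" by (metis size_mset size_union)
      thus "tensor_vec scale v w = 0" using that
        by (cases x; cases y) (auto simp: tensor_vec_def)
    qed
    thus ?thesis by (simp add: shuffle_sum_const)
  qed
  moreover have "tensor_vec scale v [] = 0" by (simp add: tensor_vec_def)
  ultimately show ?case unfolding primitive_def tensor_one_def by auto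
next
  case Lie_zero
  show ?case by (simp add: primitive_def shuffle_sum_const zero_fun_def)
next
  case (Lie_add T S)
  have eq: "T + S = (\<lambda>w. 1 * T w + 1 * S w)" by auto
  show ?case unfolding primitive_def eq shuffle_sum_linear
    using Lie_add.IH by (simp add: primitiveD algebra_simps)
next
  case (Lie_scale T c)
  have eq: "tensor_scale c T = (\<lambda>w. c * T w + 0 * T w)" by (auto simp: tensor_scale_def)
  show ?case unfolding primitive_def eq shuffle_sum_linear
    using Lie_scale.IH by (simp add: primitiveD algebra_simps)
next
  case (Lie_bracket T S)
  thus ?case by (intro primitive_bracket)
qed

section \<open>The exponential of a primitive series is a shuffle character\<close>

definition shuffle_character :: "('a list \<Rightarrow> 'k::comm_semiring_1) \<Rightarrow> bool" where
  "shuffle_character S \<longleftrightarrow> S [] = 1 \<and> (\<forall>u v. shuffle_sum S u v = S u * S v)"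

lemma shuffle_character_rev:
  "shuffle_character S \<Longrightarrow> shuffle_character (\<lambda>w. S (rev w))"
  by (simp add: shuffle_character_def shuffle_sum_rev)

text \<open>
  With the factor \<open>1 / n!\<close> built in, the binomial coefficients disappear from the coproduct of a power.
\<close>

primrec divided_power :: "('k::field_char_0, 'v) tensor \<Rightarrow> nat \<Rightarrow> ('k, 'v) tensor" where
  "divided_power L 0 = tensor_one"
| "divided_power L (Suc n) = tensor_scale (1 / of_nat (Suc n)) (L \<otimes>\<^sub>t divided_power L n)"

text \<open>
  Truncating the exponential series at the length of the word is harmless when \<open>L [] = 0\<close>, for then
  \<open>divided_power_eq_0\<close> applies to all further terms.
\<close>

definition tensor_exp :: "('k::field_char_0, 'v) tensor \<Rightarrow> ('k, 'v) tensor" where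
  "tensor_exp L = (\<lambda>w. \<Sum>n\<le>length w. divided_power L n w)"

lemma tensor_mult_divided_power:
  "(L \<otimes>\<^sub>t divided_power L n) w = of_nat (Suc n) * divided_power L (Suc n) w"
  by (simp add: tensor_scale_def del: of_nat_Suc)

lemma divided_power_eq_0:
  assumes "L [] = 0" "length w < n"
  shows "divided_power L n w = 0"
  using assms(2)
proof (induction n arbitrary: w)
  case (Suc n)
  have "L (take i w) * divided_power L n (drop i w) = 0" if "i \<le> length w" for i
  proof (cases "i = 0")
    case False
    thus ?thesis using Suc.IH[of "drop i w"] Suc.prems that by simp
  qed (simp add: assms(1))
  hence "(\<Sum>i\<le>length w. L (take i w) * divided_power L n (drop i w)) = 0"
    by (intro sum.neutral) simp
  thus ?case by (simp add: tensor_scale_def tensor_mult_def)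
qed simp

text \<open>
  The binomial theorem for \<open>L \<otimes> 1 + 1 \<otimes> L\<close>.  In the induction step the \<open>m\<close>-th summand of degree \<open>n + 1\<close>
  is obtained \<open>m\<close> times from the first and \<open>n + 1 - m\<close> times from the second kind of term.
\<close>

lemma shuffle_sum_divided_power:
  fixes L :: "('k::field_char_0, 'v) tensor"
  assumes L: "primitive L"
  shows "shuffle_sum (divided_power L n) u v =
    (\<Sum>m\<le>n. divided_power L m u * divided_power L (n - m) v)"
proof (induction n arbitrary: u v)
  case 0
  have "shuffle_sum tensor_one u v = (tensor_one u * tensor_one v :: 'k)"
  proof (cases "u = [] \<or> v = []")
    case False
    have "shuffle_sum tensor_one u v = shuffle_sum (\<lambda>_. 0 :: 'k) u v"
      by (rule shuffle_sum_cong) (use False in \<open>auto simp: tensor_one_def\<close>)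
    thus ?thesis using False by (simp add: tensor_one_def shuffle_sum_const)
  qed (auto simp: tensor_one_def)
  thus ?case by simp
next
  case (Suc n)
  let ?E = "divided_power L"
  have eq: "L \<otimes>\<^sub>t ?E n = (\<lambda>w. of_nat (Suc n) * ?E (Suc n) w + 0 * ?E n w)"
    by (rule ext) (simp only: tensor_mult_divided_power mult_zero_left add_0_right)
  have "of_nat (Suc n) * shuffle_sum (?E (Suc n)) u v = shuffle_sum (L \<otimes>\<^sub>t ?E n) u v"
    unfolding eq shuffle_sum_linear by (simp only: mult_zero_left add_0_right)
  also have "\<dots> = (\<Sum>m\<le>n. (L \<otimes>\<^sub>t ?E m) u * ?E (n - m) v) + (\<Sum>m\<le>n. ?E m u * (L \<otimes>\<^sub>t ?E (n - m)) v)"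
  proof -
    have "(\<Sum>i\<le>length u. L (take i u) * (\<Sum>m\<le>n. ?E m (drop i u) * ?E (n - m) v))
        = (\<Sum>m\<le>n. (L \<otimes>\<^sub>t ?E m) u * ?E (n - m) v)"
      unfolding tensor_mult_def sum_distrib_left sum_distrib_right
      by (subst sum.swap) (simp add: algebra_simps)
    moreover have "(\<Sum>j\<le>length v. L (take j v) * (\<Sum>m\<le>n. ?E m u * ?E (n - m) (drop j v)))
        = (\<Sum>m\<le>n. ?E m u * (L \<otimes>\<^sub>t ?E (n - m)) v)"
      unfolding tensor_mult_def sum_distrib_left sum_distrib_right
      by (subst sum.swap) (simp add: algebra_simps)
    ultimately show ?thesis unfolding shuffle_sum_primitive_mult[OF L] Suc.IH by simp
  qed
  also have "(\<Sum>m\<le>n. (L \<otimes>\<^sub>t ?E m) u * ?E (n - m) v)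
      = (\<Sum>m\<le>Suc n. of_nat m * (?E m u * ?E (Suc n - m) v))"
    unfolding tensor_mult_divided_power
    by (subst sum.atMost_Suc_shift) (simp add: algebra_simps del: divided_power.simps)
  also have "(\<Sum>m\<le>n. ?E m u * (L \<otimes>\<^sub>t ?E (n - m)) v)
      = (\<Sum>m\<le>Suc n. of_nat (Suc n - m) * (?E m u * ?E (Suc n - m) v))"
  proof -
    have "?E m u * (L \<otimes>\<^sub>t ?E (n - m)) v = of_nat (Suc n - m) * (?E m u * ?E (Suc n - m) v)"
      if "m \<in> {..n}" for m
      unfolding tensor_mult_divided_power using that
      by (simp only: atMost_iff Suc_diff_le mult.left_commute)
    hence "(\<Sum>m\<le>n. ?E m u * (L \<otimes>\<^sub>t ?E (n - m)) v)
        = (\<Sum>m\<le>n. of_nat (Suc n - m) * (?E m u * ?E (Suc n - m) v))"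
      by (rule sum.cong[OF refl])
    thus ?thesis by (simp only: sum.atMost_Suc diff_self_eq_0 of_nat_0 mult_zero_left add_0_right)
  qed
  also have "(\<Sum>m\<le>Suc n. of_nat m * (?E m u * ?E (Suc n - m) v)) +
      (\<Sum>m\<le>Suc n. of_nat (Suc n - m) * (?E m u * ?E (Suc n - m) v))
      = (\<Sum>m\<le>Suc n. of_nat (Suc n) * (?E m u * ?E (Suc n - m) v))"
    unfolding sum.distrib[symmetric] distrib_right[symmetric] of_nat_add[symmetric]
    by (rule sum.cong) (simp_all del: divided_power.simps of_nat_Suc)
  finally have "of_nat (Suc n) * shuffle_sum (?E (Suc n)) u v =
      of_nat (Suc n) * (\<Sum>m\<le>Suc n. ?E m u * ?E (Suc n - m) v)"
    by (simp only: sum_distrib_left)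
  moreover have "of_nat (Suc n) \<noteq> (0 :: 'k)"
    by (rule of_nat_neq_0)
  ultimately show ?case
    by (rule mult_left_cancel[THEN iffD1, rotated])
qed

lemma shuffle_character_tensor_exp:
  assumes L: "primitive L"
  shows "shuffle_character (tensor_exp L)"
proof -
  let ?E = "divided_power L"
  have L0: "L [] = 0"
    using primitiveD[OF L, of "[]" "[]"] by (simp add: tensor_one_def)
  have le: "n \<le> length w" if "?E n w \<noteq> 0" for n w
    using divided_power_eq_0[of L w n] L0 that by (meson not_le)
  have "shuffle_sum (tensor_exp L) u v = tensor_exp L u * tensor_exp L v" for u v
  proof -
    let ?N = "length u + length v"
    have "shuffle_sum (tensor_exp L) u v = shuffle_sum (\<lambda>w. \<Sum>n\<le>?N. ?E n w) u v"
    proof (rule shuffle_sum_cong)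
      fix w assume "mset w = mset u + mset v"
      hence "length w = ?N" by (metis size_mset size_union)
      thus "tensor_exp L w = (\<Sum>n\<le>?N. ?E n w)" by (simp add: tensor_exp_def)
    qed
    also have "\<dots> = (\<Sum>n\<le>?N. \<Sum>m\<le>n. ?E m u * ?E (n - m) v)"
      by (simp add: shuffle_sum_sum shuffle_sum_divided_power[OF L])
    also have "\<dots> = (\<Sum>(m, p)\<in>{(m, p). m + p \<le> ?N}. ?E m u * ?E p v)"
      unfolding sum.triangle_reindex_eq ..
    \<comment> \<open>The triangle and the rectangle differ only in pairs where one of the two factors vanishes.\<close>
    also have "\<dots> = (\<Sum>(m, p)\<in>{..length u} \<times> {..length v}. ?E m u * ?E p v)"
    proof (rule sum.mono_neutral_right)
      show "finite {(m, p). m + p \<le> ?N}"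
        by (rule finite_subset[of _ "{..?N} \<times> {..?N}"]) auto
    qed (auto intro: le)
    also have "\<dots> = tensor_exp L u * tensor_exp L v"
      by (simp add: tensor_exp_def sum_product sum.cartesian_product)
    finally show ?thesis .
  qed
  thus ?thesis by (simp add: shuffle_character_def tensor_exp_def tensor_one_def)
qed

section \<open>Signatures as shuffle characters\<close>

definition signature :: "(nat \<Rightarrow> ('k::field_char_0, 'v) tensor) \<Rightarrow> ('k, 'v) tensor" where
  "signature l = (\<lambda>w. sig_component (length w) l w)"

text \<open>
  As \<open>l n\<close> is supported on words of length \<open>n\<close>, this is the sum of all the \<open>l n\<close>.
\<close>

definition total_series :: "(nat \<Rightarrow> ('k::field, 'v) tensor) \<Rightarrow> ('k, 'v) tensor" where
  "total_series l = (\<lambda>w. l (length w) w)"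

lemma primitive_total_series:
  assumes "l \<in> log_signatures scale"
  shows "primitive (total_series l)"
  unfolding primitive_def
proof (intro allI)
  fix u v
  have prim: "primitive (l n)" for n
  proof (cases "n = 0")
    case True
    then show ?thesis using assms primitive_Lie[OF Lie_zero] by (simp add: log_signatures_def)
  next
    case False
    hence "l n \<in> Lie scale" using assms by (simp add: log_signatures_def Lie_deg_def)
    thus ?thesis by (rule primitive_Lie)
  qed
  have "shuffle_sum (total_series l) u v = shuffle_sum (l (length u + length v)) u v"
  proof (rule shuffle_sum_cong)
    fix w assume "mset w = mset u + mset v"
    hence "length w = length u + length v" by (metis size_mset size_union)
    thus "total_series l w = l (length u + length v) w" by (simp add: total_series_def)
  qed
  thus "shuffle_sum (total_series l) u v
      = total_series l u * tensor_one v + tensor_one u * total_series l v"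
    unfolding primitiveD[OF prim] by (auto simp: tensor_one_def total_series_def)
qed

text \<open>
  On words of length \<open>k\<close>, expanding the power of the sum and splitting by degree leaves one term for
  each composition of \<open>k\<close>, because \<open>l 0 = 0\<close> rules out parts equal to \<open>0\<close>.
\<close>

lemma divided_power_total_series:
  assumes l: "l \<in> log_signatures scale"
  shows "divided_power (total_series l) n w =
    (\<Sum>\<alpha> | \<alpha> \<in> compositions (length w) \<and> length \<alpha> = n.
       1 / fact n * foldr (\<otimes>\<^sub>t) (map l \<alpha>) tensor_one w)"
proof (induction n arbitrary: w)
  case 0
  have C: "{\<alpha>. \<alpha> \<in> compositions (length w) \<and> length \<alpha> = 0} = (if w = [] then {[]} else {})"
    by (auto simp: compositions_def)
  show ?case unfolding C by (cases "w = []") (simp_all add: tensor_one_def)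
next
  case (Suc n)
  let ?P = "\<lambda>\<alpha>. foldr (\<otimes>\<^sub>t) (map l \<alpha>) tensor_one"
  let ?k = "length w"
  let ?C = "\<lambda>n k. {\<alpha>. \<alpha> \<in> compositions k \<and> length \<alpha> = n}"
  have fin: "finite (?C n k)" for k
    using finite_compositions[of k] by simp
  have hom: "?P (i # \<beta>) w = l i (take i w) * ?P \<beta> (drop i w)" if "1 \<le> i" "i \<le> ?k" for i \<beta>
    using tensor_mult_homogeneous[of "l i" scale i w "?k - i" "?P \<beta>"] that l
    by (auto simp: log_signatures_def Lie_deg_def)
  have "divided_power (total_series l) (Suc n) w =
      1 / of_nat (Suc n) * (total_series l \<otimes>\<^sub>t divided_power (total_series l) n) w"
    by (simp only: divided_power.simps tensor_scale_def)
  also have "(total_series l \<otimes>\<^sub>t divided_power (total_series l) n) w =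
      (\<Sum>i\<le>?k. l i (take i w) * (\<Sum>\<beta>\<in>?C n (?k - i). 1 / fact n * ?P \<beta> (drop i w)))"
    unfolding tensor_mult_def Suc.IH by (intro sum.cong) (simp_all add: total_series_def)
  also have "(\<Sum>i\<le>?k. l i (take i w) * (\<Sum>\<beta>\<in>?C n (?k - i). 1 / fact n * ?P \<beta> (drop i w)))
      = (\<Sum>i\<in>{1..?k}. l i (take i w) * (\<Sum>\<beta>\<in>?C n (?k - i). 1 / fact n * ?P \<beta> (drop i w)))"
  proof (rule sum.mono_neutral_right)
    have "l 0 = 0" using l by (simp add: log_signatures_def)
    hence "l i (take i w) = 0" if "i \<in> {..?k} - {1..?k}" for i using that by (cases i) auto
    thus "\<forall>i\<in>{..?k} - {1..?k}.
        l i (take i w) * (\<Sum>\<beta>\<in>?C n (?k - i). 1 / fact n * ?P \<beta> (drop i w)) = 0"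
      by (intro ballI) (simp only: mult_zero_left)
  qed auto
  also have "\<dots> = (\<Sum>i\<in>{1..?k}. \<Sum>\<beta>\<in>?C n (?k - i). 1 / fact n * ?P (i # \<beta>) w)"
  proof (intro sum.cong refl)
    fix i assume "i \<in> {1..?k}"
    hence "?P (i # \<beta>) w = l i (take i w) * ?P \<beta> (drop i w)" for \<beta> by (intro hom) auto
    thus "l i (take i w) * (\<Sum>\<beta>\<in>?C n (?k - i). 1 / fact n * ?P \<beta> (drop i w)) =
        (\<Sum>\<beta>\<in>?C n (?k - i). 1 / fact n * ?P (i # \<beta>) w)"
      by (simp only: sum_distrib_left mult.left_commute)
  qed
  also have "\<dots> = (\<Sum>(i, \<beta>)\<in>(SIGMA i:{1..?k}. ?C n (?k - i)). 1 / fact n * ?P (i # \<beta>) w)"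
    by (rule sum.Sigma) (auto simp: fin)
  also have "\<dots> = (\<Sum>\<alpha>\<in>?C (Suc n) ?k. 1 / fact n * ?P \<alpha> w)"
    by (rule sum.reindex_bij_witness[of _ "\<lambda>\<alpha>. (hd \<alpha>, tl \<alpha>)" "\<lambda>(i, \<beta>). i # \<beta>"])
      (auto simp: compositions_def length_Suc_conv)
  also have "1 / of_nat (Suc n) * \<dots> = (\<Sum>\<alpha>\<in>?C (Suc n) ?k. 1 / fact (Suc n) * ?P \<alpha> w)"
    unfolding sum_distrib_left
  proof (rule sum.cong[OF refl])
    fix \<alpha>
    show "1 / of_nat (Suc n) * (1 / fact n * ?P \<alpha> w) = 1 / fact (Suc n) * ?P \<alpha> w"
      unfolding fact_Suc by (simp only: mult.assoc[symmetric] times_divide_times_eq mult_1)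
  qed
  finally show ?case .
qed

lemma sum_fun_apply: "(\<Sum>x\<in>A. f x) w = (\<Sum>x\<in>A. (f x w :: 'b::comm_monoid_add))"
  by (induction A rule: infinite_finite_induct) auto

lemma signature_eq_tensor_exp:
  assumes l: "l \<in> log_signatures scale"
  shows "signature l = tensor_exp (total_series l)"
proof
  fix w
  let ?P = "\<lambda>\<alpha>. foldr (\<otimes>\<^sub>t) (map l \<alpha>) tensor_one w"
  let ?C = "compositions (length w)"
  have "length \<alpha> \<le> sum_list \<alpha>" if "\<forall>a\<in>set \<alpha>. 1 \<le> a" for \<alpha> :: "nat list"
    using that by (induction \<alpha>) auto
  hence "length \<alpha> \<le> length w" if "\<alpha> \<in> ?C" for \<alpha>
    using that unfolding compositions_def by (metis (mono_tags, lifting) mem_Collect_eq)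
  hence "length ` ?C \<subseteq> {..length w}" by (simp add: image_subset_iff)
  hence "(\<Sum>n\<le>length w. \<Sum>\<alpha> | \<alpha> \<in> ?C \<and> length \<alpha> = n. 1 / fact (length \<alpha>) * ?P \<alpha>) =
      (\<Sum>\<alpha>\<in>?C. 1 / fact (length \<alpha>) * ?P \<alpha>)"
    by (intro sum.group finite_compositions) auto
  moreover have "tensor_exp (total_series l) w =
      (\<Sum>n\<le>length w. \<Sum>\<alpha> | \<alpha> \<in> ?C \<and> length \<alpha> = n. 1 / fact (length \<alpha>) * ?P \<alpha>)"
    unfolding tensor_exp_def divided_power_total_series[OF l] by (intro sum.cong refl) auto
  ultimately show "signature l w = tensor_exp (total_series l) w"
    by (simp add: signature_def sig_component_def sum_fun_apply tensor_scale_def)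
qed

lemma shuffle_character_signature:
  "l \<in> log_signatures scale \<Longrightarrow> shuffle_character (signature l)"
  by (simp add: signature_eq_tensor_exp shuffle_character_tensor_exp primitive_total_series)

lemma sig_component_tensor_power:
  assumes l: "l \<in> log_signatures scale"
  shows "sig_component k l \<in> tensor_power scale k"
proof -
  have zero: "0 \<in> tensor_power scale k" for k
    by (auto simp: tensor_power_def)
  have add: "T + S \<in> tensor_power scale k"
    if "T \<in> tensor_power scale k" "S \<in> tensor_power scale k" for T S k
    using that unfolding tensor_power_def mem_Collect_eq plus_fun_apply
    by (intro conjI allI impI) (metis add_0, metis add_0, (simp add: algebra_simps)+)
  have scl: "tensor_scale c T \<in> tensor_power scale k" if "T \<in> tensor_power scale k" for c T k
    using that by (auto simp: tensor_power_def tensor_scale_def algebra_simps)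
  have one: "tensor_one \<in> tensor_power scale 0"
    by (auto simp: tensor_power_def tensor_one_def)
  have "foldr (\<otimes>\<^sub>t) (map l \<alpha>) tensor_one \<in> tensor_power scale (sum_list \<alpha>)"
    if "\<forall>a\<in>set \<alpha>. 1 \<le> a" for \<alpha>
    using that
  proof (induction \<alpha>)
    case (Cons a \<alpha>)
    thus ?case using l by (auto simp: log_signatures_def Lie_deg_def intro!: tensor_mult_power)
  qed (simp add: one)
  hence term_mem: "tensor_scale c (foldr (\<otimes>\<^sub>t) (map l \<alpha>) tensor_one) \<in> tensor_power scale k"
    if "\<alpha> \<in> compositions k" for c \<alpha>
    using that scl unfolding compositions_def by blast
  have "(\<Sum>\<alpha>\<in>A. tensor_scale (1 / fact (length \<alpha>)) (foldr (\<otimes>\<^sub>t) (map l \<alpha>) tensor_one))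
      \<in> tensor_power scale k" if "A \<subseteq> compositions k" for A
    using that
  proof (induction A rule: infinite_finite_induct)
    case (insert x F)
    then show ?case unfolding sum.insert[OF insert(1,2)] by (intro add term_mem) auto
  qed (simp_all add: zero)
  thus ?thesis by (simp add: sig_component_def)
qed

section \<open>Characters that are symmetric in all letters but the first\<close>

text \<open>
  The symmetric degree is \<open>m + 3\<close>; writing it so makes the bound \<open>k \<ge> 4\<close> the condition \<open>0 < m\<close>.
\<close>

locale tail_symmetric_character =
  fixes S :: "'a list \<Rightarrow> 'k::field_char_0" and m :: nat
  assumes character: "shuffle_character S"
    and m_pos: "0 < m"
    and tail_symmetric: "length x = m + 2 \<Longrightarrow> mset x = mset y \<Longrightarrow> S (a # x) = S (a # y)"
begin

lemma shuffle: "S u * S v = shuffle_sum S u v"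
  using character by (simp add: shuffle_character_def)

text \<open>
  Every shuffle of \<open>a # u\<close> and \<open>b # v\<close> begins with \<open>a\<close> or with \<open>b\<close>, and \<open>S\<close> is constant on the shuffles of
  either kind.
\<close>

lemma shuffle_top_degree:
  assumes "length u + length v = m + 1"
  shows "S (a # u) * S (b # v) =
    of_nat ((m + 2) choose length u) * S (a # b # u @ v) +
    of_nat ((m + 2) choose length v) * S (b # a # u @ v)"
proof -
  have len: "length u + length (b # v) = m + 2" "length (a # u) + length v = m + 2"
    using assms by auto
  have size: "length w = m + 2" if "mset w = mset x + mset y" "length x + length y = m + 2"
    for w x y :: "'a list"
    using that by (metis size_mset size_union)
  have "shuffle_sum (\<lambda>w. S (a # w)) u (b # v) =
      of_nat ((m + 2) choose length u) * S (a # b # u @ v)"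
    unfolding len(1)[symmetric]
    by (rule shuffle_sum_constant_on, rule tail_symmetric, erule size[OF _ len(1)]) simp
  moreover have "shuffle_sum (\<lambda>w. S (b # w)) (a # u) v =
      of_nat ((m + 2) choose length (a # u)) * S (b # a # u @ v)"
    unfolding len(2)[symmetric]
    by (rule shuffle_sum_constant_on, rule tail_symmetric, erule size[OF _ len(2)]) simp
  moreover have "(m + 2) choose length (a # u) = (m + 2) choose length v"
    using len(2) by (metis add_diff_cancel_left' binomial_symmetric le_add1)
  ultimately show ?thesis by (simp only: shuffle shuffle_sum.simps)
qed

lemma shuffle_letter:
  assumes "length x = m + 1"
  shows "S [a] * S (b # x) = S (a # b # x) + of_nat (m + 2) * S (b # a # x)"
proof -
  have "(m + 2) choose (m + 1) = m + 2" by (simp add: binomial_symmetric[of "m + 1"])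
  thus ?thesis using shuffle_top_degree[of "[]" x a b] assms by simp
qed

text \<open>
  Multiplying by \<open>[a]\<close> and by \<open>[b]\<close> shows that exchanging the two first letters multiplies the value by
  \<open>- (m + 2)\<close>, in either direction.
\<close>

lemma two_kernel_letters_head:
  assumes a: "S [a] = 0" and b: "S [b] = 0" and x: "length x = m + 1"
  shows "S (a # b # x) = 0"
proof -
  have 1: "S (a # b # x) = - of_nat (m + 2) * S (b # a # x)"
    using shuffle_letter[OF x, of a b] unfolding a
    by (simp only: mult_minus_left eq_neg_iff_add_eq_0 mult_zero_left)
  have 2: "S (b # a # x) = - of_nat (m + 2) * S (a # b # x)"
    using shuffle_letter[OF x, of b a] unfolding b
    by (simp only: mult_minus_left eq_neg_iff_add_eq_0 mult_zero_left)
  have "(of_nat ((m + 2) * (m + 2)) - 1) * S (a # b # x) = 0"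
    using 1 unfolding 2 by (simp add: algebra_simps)
  moreover have "of_nat ((m + 2) * (m + 2)) \<noteq> (of_nat 1 :: 'k)"
    unfolding of_nat_eq_iff by simp
  ultimately show ?thesis by simp
qed

text \<open>
  If the first letter \<open>c\<close> is a third one, shuffling \<open>a\<close> into the word without \<open>a\<close> relates the value to a
  word beginning with \<open>a\<close>, and \<open>two_kernel_letters_head\<close> applies to that one.
\<close>

lemma two_kernel_letters:
  assumes a: "S [a] = 0" and b: "S [b] = 0" and w: "mset w = {#a, b#} + mset x"
    and x: "length x = m + 1"
  shows "S w = 0"
proof -
  have len: "length w = m + 3" using arg_cong[OF w, of size] x by simp
  then obtain c y where w': "w = c # y" "length y = m + 2" by (cases w) auto
  show ?thesis
  proof (cases "c = a \<or> c = b")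
    case True
    then obtain d where d: "(c = a \<and> d = b) \<or> (c = b \<and> d = a)" by auto
    hence "mset y = mset (d # x)" using w w' by auto
    hence "S w = S (c # d # x)" using tail_symmetric[OF w'(2)] w' by simp
    thus ?thesis using two_kernel_letters_head x a b d by auto
  next
    case False
    hence "c \<in># mset x" using w w' by (metis add_mset_add_single insert_iff set_mset_add_mset_insert
        union_iff list.set_intros(1) set_mset_mset empty_iff set_mset_empty)
    then obtain z where z: "mset x = add_mset c (mset z)"
      by (metis ex_mset mset_add)
    have lz: "length (b # z) = m + 1" using arg_cong[OF z, of size] x by simp
    have "mset y = mset (a # b # z)" using w w' z by (simp add: add_mset_commute)
    hence "S w = S (c # a # b # z)" using tail_symmetric[OF w'(2)] w' by simp
    moreover have "S (a # c # b # z) = S (a # b # c # z)"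
      by (rule tail_symmetric) (use lz in auto)
    moreover have "S (a # b # c # z) = 0"
      by (rule two_kernel_letters_head) (use a b lz in auto)
    moreover have "of_nat (m + 2) \<noteq> (0 :: 'k)" unfolding of_nat_eq_0_iff by simp
    ultimately show ?thesis using shuffle_letter[OF lz, of a c] a by auto
  qed
qed

lemma replicate_unit:
  assumes "S [e] = 1"
  shows "S (replicate n e) = 1 / fact n"
proof (induction n)
  case 0
  show ?case using character by (simp add: shuffle_character_def)
next
  case (Suc n)
  have "shuffle_sum S [e] (replicate n e) =
      of_nat ((length [e] + length (replicate n e)) choose length [e]) * S (replicate (Suc n) e)"
  proof (rule shuffle_sum_constant_on)
    fix w assume "mset w = mset [e] + mset (replicate n e)"
    hence "mset w = replicate_mset (Suc n) e" by simp
    hence "w = replicate (Suc n) e"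
      by (metis in_replicate_mset length_replicate replicate_length_same set_mset_mset size_mset
          size_replicate_mset)
    thus "S w = S (replicate (Suc n) e)" by simp
  qed
  hence "1 / fact n = of_nat (Suc n) * S (replicate (Suc n) e)"
    using Suc assms by (simp flip: shuffle)
  thus ?case by (simp add: field_simps del: of_nat_Suc)
qed

text \<open>
  This is where \<open>k \<ge> 4\<close> enters.  With \<open>M = m\<close>, \<open>g\<close> and \<open>h\<close> the values on words beginning with \<open>e\<close> and \<open>a\<close>,
  one has \<open>h = - (M + 2) * g\<close>, and the products \<open>r1\<close>, \<open>r2\<close> show that \<open>S [a, e]\<close> and
  \<open>S (a # replicate m e)\<close>, up to nonzero factors, are \<open>(M + 2) * (M + 3) * g\<close> and
  \<open>(M + 2) * M * (M + 3) * g\<close>.  Their product is \<open>0\<close> by \<open>two_kernel_letters_head\<close>.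
\<close>

lemma one_kernel_letter:
  assumes a: "S [a] = 0" and e: "S [e] = 1"
  shows "S (e # a # replicate (m + 1) e) = 0" and "S (a # replicate (m + 2) e) = 0"
proof -
  define g where "g = S (e # a # replicate (m + 1) e)"
  define h where "h = S (a # replicate (m + 2) e)"
  define M where "M = (of_nat m :: 'k)"
  define B where "B = (of_nat ((m + 2) choose 2) :: 'k)"
  have "of_nat m \<noteq> (0 :: 'k)" "of_nat (m + 2) \<noteq> (0 :: 'k)" "of_nat (m + 3) \<noteq> (0 :: 'k)"
    unfolding of_nat_eq_0_iff using m_pos by simp_all
  hence M: "M \<noteq> 0" "M + 2 \<noteq> 0" "M + 3 \<noteq> 0"
    unfolding M_def of_nat_add of_nat_numeral by simp_all
  have "2 * ((m + 2) choose 2) = (m + 2) * (m + 1)"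
    by (simp add: choose_two)
  hence "of_nat (2 * ((m + 2) choose 2)) = (of_nat ((m + 2) * (m + 1)) :: 'k)" by (rule arg_cong)
  hence B: "2 * B = (M + 2) * (M + 1)"
    by (simp add: B_def M_def algebra_simps)
  have chm: "of_nat (Suc (Suc m) choose m) = B"
    using binomial_symmetric[of m "m + 2"] by (simp add: B_def)
  have hg: "h = - (M + 2) * g"
    using shuffle_letter[of "replicate (m + 1) e" a e] a
    by (simp add: g_def h_def M_def eq_neg_iff_add_eq_0 algebra_simps)
  have ga: "S (e # a # e # replicate m e) = g" "S (a # e # e # replicate m e) = h"
    by (simp_all add: g_def h_def)
  have ge: "S (e # e # a # replicate m e) = g"
    unfolding g_def by (rule tail_symmetric) auto
  have r1: "S [a, e] * S (replicate (m + 1) e) =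
      (2 + M) * h + B * g"
    using shuffle_top_degree[of "[e]" "replicate m e" a e] ga
    by (simp add: chm M_def del: binomial_Suc_Suc)
  have r2: "S [e, e] * S (a # replicate m e) =
      (2 + M) * g + B * h"
    using shuffle_top_degree[of "[e]" "replicate m e" e a] ga ge
    by (simp add: chm M_def del: binomial_Suc_Suc)
  have "S (a # a # e # replicate m e) = 0"
    by (rule two_kernel_letters_head) (use a in auto)
  hence r3: "S [a, e] * S (a # replicate m e) = 0"
    using shuffle_top_degree[of "[e]" "replicate m e" a a] by simp
  have "2 * (S [a, e] * S (replicate (m + 1) e)) = - ((M + 2) * (M + 3) * g)"
  proof -
    have "2 * (S [a, e] * S (replicate (m + 1) e)) =
        2 * (M + 2) * h + (2 * B) * g"
      unfolding r1 by (simp add: algebra_simps)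
    thus ?thesis unfolding B hg by (simp add: algebra_simps)
  qed
  moreover have "2 * (S [e, e] * S (a # replicate m e)) = - ((M + 2) * (M * (M + 3)) * g)"
  proof -
    have "2 * (S [e, e] * S (a # replicate m e)) =
        2 * (M + 2) * g + (2 * B) * h"
      unfolding r2 by (simp add: algebra_simps)
    thus ?thesis unfolding B hg by (simp add: algebra_simps)
  qed
  ultimately have "g = 0"
    using r3 M by auto
  thus "S (e # a # replicate (m + 1) e) = 0" "S (a # replicate (m + 2) e) = 0"
    using hg by (auto simp: g_def h_def)
qed

lemma kernel_letter:
  assumes e: "S [e] = 1" and w: "length w = m + 3" "\<forall>c\<in>set w. c = e \<or> S [c] = 0"
    and a: "a \<in> set w" "S [a] = 0"
  shows "S w = 0"
proof -
  obtain x where x: "mset w = add_mset a (mset x)"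
    using a by (metis ex_mset mset_add set_mset_mset)
  have lx: "length x = m + 2" using arg_cong[OF x, of size] w by simp
  show ?thesis
  proof (cases "\<exists>b\<in>set x. S [b] = 0")
    case True
    then obtain b y where b: "S [b] = 0" and y: "mset x = add_mset b (mset y)"
      by (metis ex_mset mset_add set_mset_mset)
    have "length x = Suc (length y)" using arg_cong[OF y, of size] by simp
    thus ?thesis
      by (intro two_kernel_letters[OF a(2) b, of _ y]) (use x y lx in auto)
  next
    case False
    have "set w = insert a (set x)" using arg_cong[OF x, of set_mset] by simp
    hence "set x \<subseteq> {e}" using False w by auto
    hence xe: "x = replicate (m + 2) e" using lx
      by (metis replicate_length_same singletonD subsetD)
    obtain c y where w': "w = c # y" "length y = m + 2" using w(1) by (cases w) auto
    have cy: "add_mset c (mset y) = add_mset a (mset x)" using x unfolding w'(1) by simp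
    have "c \<in> insert a (set x)" using \<open>set w = _\<close> unfolding w'(1) by auto
    hence "c = a \<or> c = e" using \<open>set x \<subseteq> {e}\<close> by blast
    thus ?thesis
    proof
      assume "c = a"
      hence "mset y = mset x" using cy by simp
      hence "S w = S (a # x)" using tail_symmetric[OF w'(2)] w' \<open>c = a\<close> by blast
      thus ?thesis using one_kernel_letter[OF a(2) e] xe by simp
    next
      assume ce: "c = e"
      have "add_mset e (mset y) = add_mset e (mset (a # replicate (m + 1) e))"
        using cy unfolding ce xe by (simp add: add_mset_commute)
      hence "mset y = mset (a # replicate (m + 1) e)" by simp
      hence "S w = S (e # a # replicate (m + 1) e)"
        using w' ce tail_symmetric[OF w'(2)] by blast
      thus ?thesis using one_kernel_letter[OF a(2) e] by simp
    qed
  qed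
qed

text \<open>
  Filling \<open>u\<close> up with letters \<open>e\<close> to the symmetric degree, the character property reads
  \<open>S u * S r = binomial * S (u @ r)\<close> with \<open>S r \<noteq> 0\<close>.
\<close>

lemma symmetric_below_top_degree:
  assumes e: "S [e] = 1"
    and sym: "\<And>w w'. length w = m + 3 \<Longrightarrow> mset w = mset w' \<Longrightarrow> S w = S w'"
    and u: "length u \<le> m + 3" "mset u = mset u'"
  shows "S u = S u'"
proof -
  define r where "r = replicate (m + 3 - length u) e"
  have "S v * S r = of_nat ((length v + length r) choose length v) * S (u @ r)"
    if "mset v = mset u" for v
    unfolding shuffle
  proof (rule shuffle_sum_constant_on)
    fix w assume "mset w = mset v + mset r"
    hence eq: "mset (u @ r) = mset w" using that by simp
    show "S w = S (u @ r)" by (rule sym[symmetric]) (use eq u in \<open>auto simp: r_def\<close>)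
  qed
  moreover have "length u = length u'" using u(2) by (metis size_mset)
  ultimately have "S u * S r = S u' * S r" using u(2) by auto
  thus ?thesis using replicate_unit[OF e, of "m + 3 - length u"] by (simp add: r_def)
qed

end

text \<open>
  The only consequence of multilinearity that the argument needs: in any position, a letter \<open>f\<close> can be
  replaced by \<open>S [f]\<close> times \<open>e\<close> plus a kernel letter.
\<close>

locale multilinear_tail_symmetric_character = tail_symmetric_character S m
  for S :: "'a list \<Rightarrow> 'k::field_char_0" and m +
  fixes D :: "'a set" and e :: 'a
  assumes support: "S w \<noteq> 0 \<Longrightarrow> set w \<subseteq> D"
    and e: "e \<in> D" "S [e] = 1"
    and split: "f \<in> D \<Longrightarrow> \<exists>g\<in>D. S [g] = 0 \<and>
      (\<forall>x y. set x \<subseteq> D \<longrightarrow> set y \<subseteq> D \<longrightarrow>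
         S (x @ f # y) = S (x @ g # y) + S [f] * S (x @ e # y))"
begin

text \<open>
  Induction on the part \<open>y\<close> that still has arbitrary letters.  Splitting its first letter moves it into
  \<open>x\<close> as a kernel letter, where both sides vanish, or as \<open>e\<close>.
\<close>

lemma top_degree_product:
  assumes "length (x @ y) = m + 3" "set (x @ y) \<subseteq> D" "\<forall>c\<in>set x. c = e \<or> S [c] = 0"
  shows "S (x @ y) = (\<Prod>c\<leftarrow>x @ y. S [c]) * S (replicate (m + 3) e)"
  using assms
proof (induction y arbitrary: x)
  case Nil
  show ?case
  proof (cases "\<exists>a\<in>set x. S [a] = 0")
    case True
    then obtain a where a: "a \<in> set x" "S [a] = 0" by auto
    hence "(\<Prod>c\<leftarrow>x. S [c]) = 0" by (auto simp: prod_list_zero_iff)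
    thus ?thesis using kernel_letter[OF e(2) _ _ a] Nil by simp
  next
    case False
    hence "x = replicate (m + 3) e" using Nil
      by (metis append_Nil2 replicate_eqI)
    thus ?thesis using e by simp
  qed
next
  case (Cons f y)
  obtain g where g: "g \<in> D" "S [g] = 0"
      "S (x @ f # y) = S (x @ g # y) + S [f] * S (x @ e # y)"
    using split[of f] Cons.prems by auto
  show ?case
    using Cons.IH[of "x @ [g]"] Cons.IH[of "x @ [e]"] Cons.prems g e by simp
qed

lemma symmetric_up_to_top_degree:
  assumes "length u \<le> m + 3" "mset u = mset u'"
  shows "S u = S u'"
proof (rule symmetric_below_top_degree[OF e(2) _ assms])
  fix w w' :: "'a list"
  assume w: "length w = m + 3" "mset w = mset w'"
  have s: "set w = set w'" "length w' = m + 3"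
    using mset_eq_setD[OF w(2)] mset_eq_length[OF w(2)] w(1) by simp_all
  show "S w = S w'"
  proof (cases "set w \<subseteq> D")
    case True
    have "(\<Prod>c\<leftarrow>w. S [c]) = (\<Prod>c\<leftarrow>w'. S [c])"
      using w(2) by (metis mset_map prod_mset_prod_list)
    thus ?thesis
      using top_degree_product[of "[]" w] top_degree_product[of "[]" w'] w s True by simp
  next
    case False
    thus ?thesis using support s by metis
  qed
qed

end

section \<open>Back to tensors\<close>

lemma tensor_power_split:
  assumes T: "T \<in> tensor_power scale (length (x @ f # y))"
    and D: "set (x @ y) \<subseteq> dual_space scale" "f \<in> dual_space scale" "g \<in> dual_space scale"
  shows "T (x @ (f + g) # y) = T (x @ f # y) + T (x @ g # y)"
    and "T (x @ (\<lambda>z. c * f z) # y) = c * T (x @ f # y)"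
proof -
  have "T ((x @ f # y)[length x := f + g]) =
        T ((x @ f # y)[length x := f]) + T ((x @ f # y)[length x := g]) \<and>
      T ((x @ f # y)[length x := (\<lambda>z. c * f z)]) = c * T ((x @ f # y)[length x := f])"
    using T unfolding tensor_power_def mem_Collect_eq
    by (elim conjE allE[of _ "x @ f # y"] allE[of _ "length x"] allE[of _ f] allE[of _ g]
        allE[of _ c]) (use D in simp)
  thus "T (x @ (f + g) # y) = T (x @ f # y) + T (x @ g # y)"
    "T (x @ (\<lambda>z. c * f z) # y) = c * T (x @ f # y)"
    by simp_all
qed

lemma dual_space_combination:
  assumes "f \<in> dual_space scale" "g \<in> dual_space scale"
  shows "f + g \<in> dual_space scale" "(\<lambda>z. c * f z) \<in> dual_space scale"
  using assms unfolding dual_space_def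
  by (auto simp: Vector_Spaces.linear_iff algebra_simps)

text \<open>
  The letter \<open>e\<close> is a normalized functional outside the kernel of \<open>f \<mapsto> S [f]\<close>; it exists because words of
  degree \<open>k\<close> consisting of kernel letters have value \<open>0\<close>.  The decomposition of \<open>f\<close> is
  \<open>f = (f - S [f] e) + S [f] e\<close>.
\<close>

lemma homogeneous_tail_symmetric_character:
  fixes S :: "('k::field_char_0, 'v::ab_group_add) tensor"
  assumes char: "shuffle_character S"
    and hom: "\<And>n. \<exists>T\<in>tensor_power scale n. \<forall>w. length w = n \<longrightarrow> S w = T w"
    and k: "4 \<le> k"
    and tail: "\<And>a x y. length x = k - 1 \<Longrightarrow> mset x = mset y \<Longrightarrow> S (a # x) = S (a # y)"
    and nz: "length w = k" "S w \<noteq> 0"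
    and u: "length u \<le> k" "mset u = mset u'"
  shows "S u = S u'"
proof -
  let ?D = "dual_space scale"
  obtain m where m: "k = m + 3" "0 < m"
    using k by (intro that[of "k - 3"]) auto
  interpret tail_symmetric_character S m
  proof
    show "S (a # x) = S (a # y)" if "length x = m + 2" "mset x = mset y" for a x y
      by (rule tail) (use that m(1) in simp_all)
  qed (fact char m(2))+
  have supp: "set w \<subseteq> ?D" if "S w \<noteq> 0" for w
  proof -
    obtain T where "T \<in> tensor_power scale (length w)" "T w = S w"
      using hom[of "length w"] by auto
    thus ?thesis using that unfolding tensor_power_def by simp
  qed
  have add: "S (x @ (f + g) # y) = S (x @ f # y) + S (x @ g # y)"
    and scl: "S (x @ (\<lambda>z. c * f z) # y) = c * S (x @ f # y)"
    if D: "set x \<subseteq> ?D" "set y \<subseteq> ?D" "f \<in> ?D" "g \<in> ?D" for x y f g c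
  proof -
    obtain T where T: "T \<in> tensor_power scale (length (x @ f # y))"
      and ST: "\<And>w. length w = length (x @ f # y) \<Longrightarrow> S w = T w"
      using hom by blast
    show "S (x @ (f + g) # y) = S (x @ f # y) + S (x @ g # y)"
      "S (x @ (\<lambda>z. c * f z) # y) = c * S (x @ f # y)"
      using tensor_power_split(1)[OF T _ D(3,4)] tensor_power_split(2)[OF T _ D(3,4), of c] D(1,2)
      by (simp_all add: ST)
  qed
  have "\<exists>e0. S [e0] \<noteq> 0"
  proof (rule ccontr)
    assume no: "\<nexists>e0. S [e0] \<noteq> 0"
    obtain a b x where "w = a # b # x" "length x = m + 1"
      using nz(1) m(1) by (auto simp: numeral_eq_Suc length_Suc_conv)
    thus False using nz(2) two_kernel_letters_head no by blast
  qed
  then obtain e0 where e0: "S [e0] \<noteq> 0" by auto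
  have e0D: "e0 \<in> ?D" using supp[OF e0] by simp
  define e where "e = (\<lambda>z. (1 / S [e0]) * e0 z)"
  have eD: "e \<in> ?D" unfolding e_def by (rule dual_space_combination(2)[OF e0D e0D])
  have e1: "S [e] = 1"
    using scl[of "[]" "[]" e0 e0 "1 / S [e0]"] e0 e0D by (simp add: e_def)
  interpret multilinear_tail_symmetric_character S m ?D e
  proof unfold_locales
    fix f assume f: "f \<in> ?D"
    define h where "h = (\<lambda>z. (- S [f]) * e z)"
    have hD: "h \<in> ?D" unfolding h_def by (rule dual_space_combination(2)[OF eD eD])
    have gD: "f + h \<in> ?D" by (rule dual_space_combination(1)[OF f hD])
    have eq: "S (x @ (f + h) # y) = S (x @ f # y) - S [f] * S (x @ e # y)"
      if "set x \<subseteq> ?D" "set y \<subseteq> ?D" for x y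
      using add[OF that f hD] scl[OF that eD eD, of "- S [f]"] unfolding h_def by simp
    show "\<exists>g\<in>?D. S [g] = 0 \<and> (\<forall>x y. set x \<subseteq> ?D \<longrightarrow> set y \<subseteq> ?D \<longrightarrow>
         S (x @ f # y) = S (x @ g # y) + S [f] * S (x @ e # y))"
      using gD eq eq[of "[]" "[]"] e1 by (intro bexI[of _ "f + h"]) auto
  qed (use supp eD e1 in auto)
  show ?thesis using symmetric_up_to_top_degree u m(1) by simp
qed

text \<open>
  Reversal turns the case of \<open>Sym_tensor_V\<close> into that of \<open>V_tensor_Sym\<close>.
\<close>

lemma tensor_power_rev:
  assumes T: "T \<in> tensor_power scale k"
  shows "(\<lambda>w. T (rev w)) \<in> tensor_power scale k"
proof -
  have "T (rev (w[i := f + g])) = T (rev (w[i := f])) + T (rev (w[i := g])) \<and>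
      T (rev (w[i := (\<lambda>x. c * f x)])) = c * T (rev (w[i := f]))"
    if "length w = k" "set w \<subseteq> dual_space scale" "i < k"
      "f \<in> dual_space scale" "g \<in> dual_space scale" for w i f g c
    using T that unfolding tensor_power_def by (simp add: rev_update)
  moreover have "length w = k \<and> set w \<subseteq> dual_space scale" if "T (rev w) \<noteq> 0" for w
    using T that unfolding tensor_power_def mem_Collect_eq by (metis length_rev set_rev)
  ultimately show ?thesis unfolding tensor_power_def by blast
qed

lemma V_tensor_Sym_tail:
  assumes T: "T \<in> V_tensor_Sym scale (Suc n)" and x: "length x = n" "mset x = mset y"
  shows "T (a # x) = T (a # y)"
proof -
  obtain p where p: "p permutes {..<length y}" "permute_list p y = x"
    using mset_eq_permutation[OF x(2)] by blast
  have ly: "length y = n" using x by (metis size_mset)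
  \<comment> \<open>\<open>p\<close> moved by one position, fixing the first letter.\<close>
  let ?q = "\<lambda>i. case i of 0 \<Rightarrow> 0 | Suc j \<Rightarrow> Suc (p j)"
  have q: "?q permutes {1..<Suc n}"
  proof (rule bij_imp_permutes)
    have "bij_betw p {..<n} {..<n}" using p(1) ly by (simp add: permutes_imp_bij)
    moreover have "bij_betw Suc {..<n} {1..<Suc n}"
      by (simp add: bij_betw_def lessThan_atLeast0 image_Suc_atLeastLessThan)
    moreover have "bij_betw (\<lambda>i. i - 1) {1..<Suc n} {..<n}"
      by (rule bij_betw_byWitness[of _ Suc]) auto
    ultimately have "bij_betw (Suc \<circ> p \<circ> (\<lambda>i. i - 1)) {1..<Suc n} {1..<Suc n}"
      by (meson bij_betw_trans)
    thus "bij_betw ?q {1..<Suc n} {1..<Suc n}"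
      by (rule bij_betw_cong[THEN iffD1, rotated]) (auto split: nat.split)
  next
    fix i assume "i \<notin> {1..<Suc n}"
    thus "?q i = i" using p(1) ly by (auto split: nat.split intro: permutes_not_in)
  qed
  have "permute_list ?q (a # y) = a # permute_list p y"
    unfolding permute_list_def by (simp add: upt_conv_Cons map_Suc_upt[symmetric] del: upt_Suc)
  moreover have "T (permute_list ?q (a # y)) = T (a # y)"
    using T q ly unfolding V_tensor_Sym_def invariant_tensors_def by auto
  ultimately show ?thesis using p(2) by simp
qed

lemma Sym_tensor_V_init:
  assumes T: "T \<in> Sym_tensor_V scale (Suc n)" and x: "length x = n" "mset x = mset y"
  shows "T (x @ [a]) = T (y @ [a])"
proof -
  obtain p where p: "p permutes {..<length y}" "permute_list p y = x"
    using mset_eq_permutation[OF x(2)] by blast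
  have ly: "length y = n" using x by (metis size_mset)
  have "permute_list p (y @ [a]) = permute_list p y @ [a]"
    unfolding permute_list_def
    using permutes_in_image[OF p(1)] permutes_not_in[OF p(1), of "length y"]
    by (auto simp: nth_append)
  moreover have "T (permute_list p (y @ [a])) = T (y @ [a])"
    using T p(1) ly unfolding Sym_tensor_V_def invariant_tensors_def
    by (auto simp: lessThan_atLeast0)
  ultimately show ?thesis using p(2) by simp
qed

theorem corollary5p9:
  fixes scale :: "'k::real_normed_field \<Rightarrow> 'v::ab_group_add \<Rightarrow> 'v"
    and Basis :: "'v set" and l :: "nat \<Rightarrow> ('k, 'v) tensor" and k :: nat
  assumes "finite_dimensional_vector_space scale Basis"
    and "k \<ge> 4"
    and "l \<in> log_signatures scale"
    and "sig_component k l \<noteq> 0"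
    and "sig_component k l \<in> Sym_tensor_V scale k \<or> sig_component k l \<in> V_tensor_Sym scale k"
  shows "\<forall>i\<in>{2..k}. sig_component i l \<in> Sym scale i"
proof
  note l = assms(3) and k = assms(2)
  let ?S = "signature l"
  have S: "sig_component n l w = ?S w" if "length w = n" for n w
    using that by (simp add: signature_def)
  have power: "sig_component n l \<in> tensor_power scale n" for n
    by (rule sig_component_tensor_power[OF l])
  have homogeneous: "\<exists>T\<in>tensor_power scale n. \<forall>w. length w = n \<longrightarrow> ?S w = T w" for n
    by (rule bexI[OF _ power]) (simp add: signature_def)
  have k': "k = Suc (k - 1)" using k by simp
  obtain w where w: "sig_component k l w \<noteq> 0" using assms(4) by (auto simp: fun_eq_iff)
  hence lw: "length w = k" using power[of k] unfolding tensor_power_def by blast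
  have nz: "?S w \<noteq> 0" using w S[OF lw] by simp
  have symmetric: "?S u = ?S u'" if u: "length u \<le> k" "mset u = mset u'" for u u'
    using assms(5)
  proof
    assume "sig_component k l \<in> V_tensor_Sym scale k"
    hence "sig_component k l (a # x) = sig_component k l (a # y)"
      if "length x = k - 1" "mset x = mset y" for a x y
      using V_tensor_Sym_tail[of _ scale "k - 1" x y a] that k' by simp
    hence tail: "?S (a # x) = ?S (a # y)" if "length x = k - 1" "mset x = mset y" for a x y
      using that k' S by (metis length_Cons size_mset)
    show ?thesis
      by (rule homogeneous_tail_symmetric_character[OF shuffle_character_signature[OF l]
            homogeneous k tail lw nz u])
  next
    assume "sig_component k l \<in> Sym_tensor_V scale k"
    hence "sig_component k l (x @ [a]) = sig_component k l (y @ [a])"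
      if "length x = k - 1" "mset x = mset y" for a x y
      using Sym_tensor_V_init[of _ scale "k - 1" x y a] that k' by simp
    hence init: "?S (x @ [a]) = ?S (y @ [a])" if "length x = k - 1" "mset x = mset y" for a x y
      using that k' S by (metis length_append_singleton size_mset)
    have "(\<lambda>w. ?S (rev w)) (rev u) = (\<lambda>w. ?S (rev w)) (rev u')"
    proof (rule homogeneous_tail_symmetric_character[OF
          shuffle_character_rev[OF shuffle_character_signature[OF l]] _ k])
      show "\<exists>T\<in>tensor_power scale n. \<forall>w. length w = n \<longrightarrow> ?S (rev w) = T w" for n
        by (rule bexI[OF _ tensor_power_rev[OF power]]) (simp add: signature_def)
      show "?S (rev (a # x)) = ?S (rev (a # y))" if "length x = k - 1" "mset x = mset y" for a x y
        using init[of "rev x" "rev y" a] that by simp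
      show "length (rev w) = k" "?S (rev (rev w)) \<noteq> 0" using lw nz by auto
    qed (use u in auto)
    thus ?thesis by simp
  qed
  fix i assume i: "i \<in> {2..k}"
  show "sig_component i l \<in> Sym scale i"
    unfolding Sym_def invariant_tensors_def mem_Collect_eq
  proof (intro conjI allI impI power)
    fix p and w :: "('v \<Rightarrow> 'k) list"
    assume p: "p permutes {0..<i}" and w: "length w = i"
    have "mset (permute_list p w) = mset w"
      using p w by (intro mset_permute_list) (simp add: lessThan_atLeast0)
    hence "?S (permute_list p w) = ?S w" by (intro symmetric) (use i w in simp_all)
    thus "sig_component i l (permute_list p w) = sig_component i l w" using w by (simp add: S)
  qed
qed

end
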